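(* Let $(\Omega,\Sigma,\mu)$ be an arbitrary measure space and let $1\le p<\infty$. Then for every $n\in\mathbb{N}$ with $n\ge p$, the Banach lattice $L_p(\mu)$ is an $n$-PPS lattice.
   Context: Banach lattices are real; $L_p(\mu)$ carries its usual norm and the $\mu$-almost everywhere pointwise order. A scalar-valued $n$-homogeneous polynomial $P$ on a Banach lattice $E$ is a map $P(x)=A(x,\dots,x)$ for a (unique) symmetric $n$-linear form $A:E^n\to\mathbb{R}$; $P$ is positive if $A(x_1,\dots,x_n)\ge 0$ whenever $x_1,\dots,x_n\ge 0$; $P$ is regular if it is the difference of two positive $n$-homogeneous polynomials. A vector $x$ is called positive if $x\ge 0$. For $n\in\mathbb{N}$, a Banach lattice $E$ is an $n$-PPS lattice (has the $n$-positive polynomial Schur property) if every weakly null sequence $(x_j)_{j=1}^\infty$ in $E$ formed by positive vectors such that $P(x_j)\to 0$ for every regular $n$-homogeneous polynomial $P$ on $E$ is norm null. *)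

theory Defs
  imports "HOL-Analysis.Analysis"
begin

section \<open>Banach lattices\<close>

text \<open>
  \<open>L\<^sub>p(\<mu>)\<close> depends on the measure and on the exponent, so it is not a type. Banach lattices are
  therefore records with an explicit carrier; the components are relevant on the carrier only.
\<close>

record 'v riesz_structure =
  vcarrier :: "'v set"
  vzero :: 'v
  vadd :: "'v \<Rightarrow> 'v \<Rightarrow> 'v"
  vscale :: "real \<Rightarrow> 'v \<Rightarrow> 'v"
  vle :: "'v \<Rightarrow> 'v \<Rightarrow> bool"
  vnorm :: "'v \<Rightarrow> real"

definition vneg :: "'v riesz_structure \<Rightarrow> 'v \<Rightarrow> 'v" where
  "vneg E x = vscale E (-1) x"

definition vdiff :: "'v riesz_structure \<Rightarrow> 'v \<Rightarrow> 'v \<Rightarrow> 'v" where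
  "vdiff E x y = vadd E x (vneg E y)"

definition is_vsup :: "'v riesz_structure \<Rightarrow> 'v \<Rightarrow> 'v \<Rightarrow> 'v \<Rightarrow> bool" where
  "is_vsup E x y s \<longleftrightarrow> s \<in> vcarrier E \<and> vle E x s \<and> vle E y s \<and>
     (\<forall>u\<in>vcarrier E. vle E x u \<and> vle E y u \<longrightarrow> vle E s u)"

definition is_vinf :: "'v riesz_structure \<Rightarrow> 'v \<Rightarrow> 'v \<Rightarrow> 'v \<Rightarrow> bool" where
  "is_vinf E x y i \<longleftrightarrow> i \<in> vcarrier E \<and> vle E i x \<and> vle E i y \<and>
     (\<forall>l\<in>vcarrier E. vle E l x \<and> vle E l y \<longrightarrow> vle E l i)"

definition vabs :: "'v riesz_structure \<Rightarrow> 'v \<Rightarrow> 'v" where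
  "vabs E x = (THE s. is_vsup E x (vneg E x) s)"

locale real_vector_structure =
  fixes E :: "'v riesz_structure"
  assumes zero_closed: "vzero E \<in> vcarrier E"
    and add_closed: "\<lbrakk>x \<in> vcarrier E; y \<in> vcarrier E\<rbrakk> \<Longrightarrow> vadd E x y \<in> vcarrier E"
    and scale_closed: "x \<in> vcarrier E \<Longrightarrow> vscale E a x \<in> vcarrier E"
    and add_assoc: "\<lbrakk>x \<in> vcarrier E; y \<in> vcarrier E; z \<in> vcarrier E\<rbrakk>
          \<Longrightarrow> vadd E (vadd E x y) z = vadd E x (vadd E y z)"
    and add_commute: "\<lbrakk>x \<in> vcarrier E; y \<in> vcarrier E\<rbrakk> \<Longrightarrow> vadd E x y = vadd E y x"
    and add_zero: "x \<in> vcarrier E \<Longrightarrow> vadd E x (vzero E) = x"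
    and add_neg: "x \<in> vcarrier E \<Longrightarrow> vadd E x (vneg E x) = vzero E"
    and scale_add_right: "\<lbrakk>x \<in> vcarrier E; y \<in> vcarrier E\<rbrakk>
          \<Longrightarrow> vscale E a (vadd E x y) = vadd E (vscale E a x) (vscale E a y)"
    and scale_add_left: "x \<in> vcarrier E
          \<Longrightarrow> vscale E (a + b) x = vadd E (vscale E a x) (vscale E b x)"
    and scale_scale: "x \<in> vcarrier E \<Longrightarrow> vscale E a (vscale E b x) = vscale E (a * b) x"
    and scale_one: "x \<in> vcarrier E \<Longrightarrow> vscale E 1 x = x"

locale banach_structure = real_vector_structure +
  assumes norm_eq_zero: "x \<in> vcarrier E \<Longrightarrow> vnorm E x = 0 \<longleftrightarrow> x = vzero E"
    and norm_scale: "x \<in> vcarrier E \<Longrightarrow> vnorm E (vscale E a x) = \<bar>a\<bar> * vnorm E x"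
    and norm_triangle: "\<lbrakk>x \<in> vcarrier E; y \<in> vcarrier E\<rbrakk>
          \<Longrightarrow> vnorm E (vadd E x y) \<le> vnorm E x + vnorm E y"
    and complete: "\<lbrakk>\<And>j. s j \<in> vcarrier E;
            \<And>e. e > 0 \<Longrightarrow> \<exists>N. \<forall>i\<ge>N. \<forall>j\<ge>N. vnorm E (vdiff E (s i) (s j)) < e\<rbrakk>
          \<Longrightarrow> \<exists>l\<in>vcarrier E. (\<lambda>j. vnorm E (vdiff E (s j) l)) \<longlonglongrightarrow> 0"

locale banach_lattice = banach_structure +
  assumes le_refl: "x \<in> vcarrier E \<Longrightarrow> vle E x x"
    and le_trans: "\<lbrakk>x \<in> vcarrier E; y \<in> vcarrier E; z \<in> vcarrier E; vle E x y; vle E y z\<rbrakk>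
          \<Longrightarrow> vle E x z"
    and le_antisym: "\<lbrakk>x \<in> vcarrier E; y \<in> vcarrier E; vle E x y; vle E y x\<rbrakk> \<Longrightarrow> x = y"
    and le_add: "\<lbrakk>x \<in> vcarrier E; y \<in> vcarrier E; z \<in> vcarrier E; vle E x y\<rbrakk>
          \<Longrightarrow> vle E (vadd E x z) (vadd E y z)"
    and le_scale: "\<lbrakk>x \<in> vcarrier E; y \<in> vcarrier E; a \<ge> 0; vle E x y\<rbrakk>
          \<Longrightarrow> vle E (vscale E a x) (vscale E a y)"
    and sup_exists: "\<lbrakk>x \<in> vcarrier E; y \<in> vcarrier E\<rbrakk> \<Longrightarrow> \<exists>s. is_vsup E x y s"
    and inf_exists: "\<lbrakk>x \<in> vcarrier E; y \<in> vcarrier E\<rbrakk> \<Longrightarrow> \<exists>i. is_vinf E x y i"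
    and norm_mono: "\<lbrakk>x \<in> vcarrier E; y \<in> vcarrier E; vle E (vabs E x) (vabs E y)\<rbrakk>
          \<Longrightarrow> vnorm E x \<le> vnorm E y"


section \<open>Weak convergence and regular homogeneous polynomials\<close>

definition linear_functional :: "'v riesz_structure \<Rightarrow> ('v \<Rightarrow> real) \<Rightarrow> bool" where
  "linear_functional E \<phi> \<longleftrightarrow>
     (\<forall>x\<in>vcarrier E. \<forall>y\<in>vcarrier E. \<phi> (vadd E x y) = \<phi> x + \<phi> y) \<and>
     (\<forall>a. \<forall>x\<in>vcarrier E. \<phi> (vscale E a x) = a * \<phi> x)"

definition bounded_functional :: "'v riesz_structure \<Rightarrow> ('v \<Rightarrow> real) \<Rightarrow> bool" where
  "bounded_functional E \<phi> \<longleftrightarrow>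
     linear_functional E \<phi> \<and> (\<exists>C. \<forall>x\<in>vcarrier E. \<bar>\<phi> x\<bar> \<le> C * vnorm E x)"

definition weakly_null :: "'v riesz_structure \<Rightarrow> (nat \<Rightarrow> 'v) \<Rightarrow> bool" where
  "weakly_null E s \<longleftrightarrow> (\<forall>\<phi>. bounded_functional E \<phi> \<longrightarrow> (\<lambda>j. \<phi> (s j)) \<longlonglongrightarrow> 0)"

definition norm_null :: "'v riesz_structure \<Rightarrow> (nat \<Rightarrow> 'v) \<Rightarrow> bool" where
  "norm_null E s \<longleftrightarrow> (\<lambda>j. vnorm E (s j)) \<longlonglongrightarrow> 0"

text \<open>\<open>E\<^sup>n\<close>, with coordinates indexed by \<open>0, \<dots>, n - 1\<close>.\<close>

definition tuples :: "nat \<Rightarrow> 'v riesz_structure \<Rightarrow> (nat \<Rightarrow> 'v) set" where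
  "tuples n E = ({..<n} \<rightarrow>\<^sub>E vcarrier E)"

definition symmetric_multilinear ::
    "nat \<Rightarrow> 'v riesz_structure \<Rightarrow> ((nat \<Rightarrow> 'v) \<Rightarrow> real) \<Rightarrow> bool" where
  "symmetric_multilinear n E A \<longleftrightarrow>
     (\<forall>v\<in>tuples n E. \<forall>i<n. linear_functional E (\<lambda>x. A (v(i := x)))) \<and>
     (\<forall>v\<in>tuples n E. \<forall>\<pi>. \<pi> permutes {..<n} \<longrightarrow> A (v \<circ> \<pi>) = A v)"

text \<open>
  The symmetric form is uniquely determined by the polynomial. As usual for polynomials on Banach
  lattices, positive polynomials are not required to be continuous: this is automatic.
\<close>

definition poly_of_form ::
    "nat \<Rightarrow> 'v riesz_structure \<Rightarrow> ((nat \<Rightarrow> 'v) \<Rightarrow> real) \<Rightarrow> ('v \<Rightarrow> real) \<Rightarrow> bool" where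
  "poly_of_form n E A P \<longleftrightarrow>
     symmetric_multilinear n E A \<and> (\<forall>x\<in>vcarrier E. P x = A (\<lambda>i\<in>{..<n}. x))"

definition homogeneous_poly :: "nat \<Rightarrow> 'v riesz_structure \<Rightarrow> ('v \<Rightarrow> real) \<Rightarrow> bool" where
  "homogeneous_poly n E P \<longleftrightarrow> (\<exists>A. poly_of_form n E A P)"

definition positive_poly :: "nat \<Rightarrow> 'v riesz_structure \<Rightarrow> ('v \<Rightarrow> real) \<Rightarrow> bool" where
  "positive_poly n E P \<longleftrightarrow>
     (\<exists>A. poly_of_form n E A P \<and>
        (\<forall>v\<in>tuples n E. (\<forall>i<n. vle E (vzero E) (v i)) \<longrightarrow> A v \<ge> 0))"

definition regular_poly :: "nat \<Rightarrow> 'v riesz_structure \<Rightarrow> ('v \<Rightarrow> real) \<Rightarrow> bool" where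
  "regular_poly n E P \<longleftrightarrow> homogeneous_poly n E P \<and>
     (\<exists>Q R. positive_poly n E Q \<and> positive_poly n E R \<and> (\<forall>x\<in>vcarrier E. P x = Q x - R x))"

definition n_PPS_lattice :: "nat \<Rightarrow> 'v riesz_structure \<Rightarrow> bool" where
  "n_PPS_lattice n E \<longleftrightarrow> banach_lattice E \<and>
     (\<forall>s. (\<forall>j. s j \<in> vcarrier E \<and> vle E (vzero E) (s j)) \<and>
          weakly_null E s \<and>
          (\<forall>P. regular_poly n E P \<longrightarrow> (\<lambda>j. P (s j)) \<longlonglongrightarrow> 0)
        \<longrightarrow> norm_null E s)"


section \<open>The Banach lattice \<open>L\<^sub>p(\<mu>)\<close>\<close>

definition Lp_funs :: "real \<Rightarrow> 'a measure \<Rightarrow> ('a \<Rightarrow> real) set" where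
  "Lp_funs p M = {f \<in> borel_measurable M. integrable M (\<lambda>x. \<bar>f x\<bar> powr p)}"

definition Lp_rel :: "real \<Rightarrow> 'a measure \<Rightarrow> (('a \<Rightarrow> real) \<times> ('a \<Rightarrow> real)) set" where
  "Lp_rel p M = {(f, g). f \<in> Lp_funs p M \<and> g \<in> Lp_funs p M \<and> (AE x in M. f x = g x)}"

text \<open>
  The elements are the almost-everywhere classes of \<open>p\<close>-integrable functions. The unions over
  representatives in the operations are unions of a single class.
\<close>

definition Lp :: "real \<Rightarrow> 'a measure \<Rightarrow> ('a \<Rightarrow> real) set riesz_structure" where
  "Lp p M = \<lparr>
     vcarrier = Lp_funs p M // Lp_rel p M,
     vzero = Lp_rel p M `` {\<lambda>_. 0},
     vadd = (\<lambda>X Y. \<Union>f\<in>X. \<Union>g\<in>Y. Lp_rel p M `` {\<lambda>x. f x + g x}),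
     vscale = (\<lambda>a X. \<Union>f\<in>X. Lp_rel p M `` {\<lambda>x. a * f x}),
     vle = (\<lambda>X Y. \<exists>f\<in>X. \<exists>g\<in>Y. AE x in M. f x \<le> g x),
     vnorm = (\<lambda>X. the_elem ((\<lambda>f. (\<integral>x. \<bar>f x\<bar> powr p \<partial>M) powr (1 / p)) ` X))\<rparr>"

end

theory Submission
  imports Defs
begin

text \<open>
  Write \<open>s j\<close> for a weakly null sequence of positive elements, represented by functions
  \<open>f j \<ge> 0\<close>. If it is not norm null, infinitely many norms stay above some \<open>\<epsilon> > 0\<close>, and the aim
  is a positive \<open>n\<close>-homogeneous polynomial that stays away from \<open>0\<close> along a subsequence.

  Were the \<open>f k\<close> disjointly supported, one could take the norming functionals
  \<open>\<phi> k g = (\<integral> g * f k powr (p - 1)) / \<parallel>f k\<parallel> powr (p - 1)\<close>. Each sees \<open>g\<close> only on the support of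
  \<open>f k\<close>, so \<open>g \<mapsto> (\<phi> k g)\<close> maps \<open>L\<^sub>p\<close> into the sequence space \<open>l\<^sub>p\<close>. As \<open>n \<ge> p\<close>, this space is
  contained in \<open>l\<^sub>n\<close>, so \<open>P g = (\<Sum>k. \<phi> k g ^ n)\<close> is a well-defined positive polynomial, and
  \<open>P (f k) \<ge> \<phi> k (f k) ^ n \<ge> \<epsilon> ^ n\<close>.

  Weak nullity makes the sequence almost disjoint. Indeed
  \<open>min a b powr p \<le> a * b powr (p - 1)\<close>, and pairing with \<open>f i powr (p - 1)\<close> is a bounded
  functional, so for fixed \<open>i\<close> the functions \<open>min (f i) (f j)\<close> tend to \<open>0\<close> in norm as \<open>j\<close> grows
  (lemma \<open>pint_min_le\<close>). Along a sparse subsequence these overlaps are summable with a small sum.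
  Then \<open>f k\<close> keeps at least half of its \<open>p\<close>-th power integral on the set where it strictly exceeds
  all other terms: outside this set \<open>f k\<close> equals some \<open>min (f i) (f k)\<close>
  (lemma \<open>pint_le_dominance_set\<close>). These sets are disjoint, and cutting \<open>f k\<close> down to them
  before forming \<open>\<phi> k\<close> costs only a factor \<open>2\<close> (lemma \<open>regular_poly_bounded_below\<close>).

  The definition of an \<open>n\<close>-PPS lattice also asks that \<open>L\<^sub>p(\<mu>)\<close> be a Banach lattice. This is
  Minkowski's inequality, from the convexity of \<open>t \<mapsto> t powr p\<close>, and the Riesz--Fischer
  theorem, transported from functions to almost-everywhere classes.
\<close>

section \<open>Inequalities for powers of real numbers\<close>

text \<open>
  Convexity of \<open>t \<mapsto> t powr p\<close> up to the boundary point \<open>0\<close>, where it reduces to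
  \<open>t powr p \<le> t\<close> on the unit interval.
\<close>

lemma powr_convex_combination:
  fixes t u v p :: real
  assumes "1 \<le> p" "0 \<le> t" "t \<le> 1" "0 \<le> u" "0 \<le> v"
  shows "((1 - t) * u + t * v) powr p \<le> (1 - t) * u powr p + t * v powr p"
proof -
  have shrink: "(s * w) powr p \<le> s * w powr p" if "0 \<le> s" "s \<le> 1" "0 \<le> w" for s w :: real
  proof (cases "s = 0")
    case False
    then have "s powr p \<le> s powr 1"
      using that \<open>1 \<le> p\<close> by (intro powr_mono') auto
    then show ?thesis
      using that False by (simp add: powr_mult mult_right_mono)
  qed simp
  consider "u = 0" | "v = 0" | "0 < u" "0 < v"
    using assms by linarith
  then show ?thesis
  proof cases
    case 1
    then show ?thesis using shrink[of t v] assms by simp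
  next
    case 2
    then show ?thesis using shrink[of "1 - t" u] assms by simp
  next
    case 3
    then show ?thesis
      using convex_onD[OF powr_convex[OF \<open>1 \<le> p\<close>], of t u v] assms by simp
  qed
qed

text \<open>
  A crude form of Young's inequality: replacing both factors by the larger of \<open>a\<close> and \<open>b\<close> gives
  \<open>max a b powr p\<close>. The constants are immaterial below, so it stands in for Hoelder's inequality.
\<close>

lemma mult_powr_minus_one_le:
  fixes a b p :: real
  assumes "1 \<le> p" "0 \<le> a" "0 \<le> b"
  shows "a * b powr (p - 1) \<le> a powr p + b powr p"
proof -
  have pow: "c * c powr (p - 1) = c powr p" if "0 \<le> c" for c :: real
    using powr_mult_base[OF that, of "p - 1"] by simp
  show ?thesis
  proof (cases "a \<le> b")
    case True
    then have "a * b powr (p - 1) \<le> b * b powr (p - 1)"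
      by (intro mult_right_mono) auto
    then show ?thesis using pow[OF \<open>0 \<le> b\<close>] by (simp add: add_increasing)
  next
    case False
    then have "a * b powr (p - 1) \<le> a * a powr (p - 1)"
      using assms by (intro mult_left_mono powr_mono2) auto
    then show ?thesis using pow[OF \<open>0 \<le> a\<close>] by (simp add: add_increasing2)
  qed
qed

text \<open>
  This turns weak convergence into smallness of overlaps: its right-hand side is linear in \<open>a\<close>.
\<close>

lemma min_powr_le:
  fixes a b p :: real
  assumes "1 \<le> p" "0 \<le> a" "0 \<le> b"
  shows "min a b powr p \<le> a * b powr (p - 1)"
proof -
  have "min a b powr p = min a b * min a b powr (p - 1)"
    using powr_mult_base[of "min a b" "p - 1"] assms by simp
  also have "\<dots> \<le> a * b powr (p - 1)"
    using assms by (intro mult_mono powr_mono2) auto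
  finally show ?thesis .
qed

section \<open>The function space and its norm\<close>

locale lebesgue_exponent =
  fixes p :: real and M :: "'a measure"
  assumes one_le_p: "1 \<le> p"
begin

lemma p_pos: "0 < p"
  using one_le_p by simp

definition pint :: "('a \<Rightarrow> real) \<Rightarrow> real" where
  "pint f = (\<integral>x. \<bar>f x\<bar> powr p \<partial>M)"

definition pnorm :: "('a \<Rightarrow> real) \<Rightarrow> real" where
  "pnorm f = pint f powr (1 / p)"

lemma Lp_measurable [measurable_dest]: "f \<in> Lp_funs p M \<Longrightarrow> f \<in> borel_measurable M"
  by (simp add: Lp_funs_def)

lemma Lp_integrable: "f \<in> Lp_funs p M \<Longrightarrow> integrable M (\<lambda>x. \<bar>f x\<bar> powr p)"
  by (simp add: Lp_funs_def)

lemma Lp_dominated: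
  assumes "g \<in> Lp_funs p M" "f \<in> borel_measurable M" "AE x in M. \<bar>f x\<bar> \<le> \<bar>g x\<bar>"
  shows "f \<in> Lp_funs p M"
proof -
  have "integrable M (\<lambda>x. \<bar>f x\<bar> powr p)"
  proof (rule Bochner_Integration.integrable_bound[OF Lp_integrable[OF assms(1)]])
    show "AE x in M. norm (\<bar>f x\<bar> powr p) \<le> norm (\<bar>g x\<bar> powr p)"
      using assms(3) by eventually_elim (use p_pos in \<open>auto intro: powr_mono2\<close>)
  qed (use assms(2) in measurable)
  then show ?thesis using assms(2) by (simp add: Lp_funs_def)
qed

lemma Lp_zero: "(\<lambda>_. 0) \<in> Lp_funs p M"
  by (simp add: Lp_funs_def)

lemma Lp_scale: "f \<in> Lp_funs p M \<Longrightarrow> (\<lambda>x. a * f x) \<in> Lp_funs p M"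
  by (auto simp: Lp_funs_def abs_mult powr_mult)

lemma Lp_add:
  assumes "f \<in> Lp_funs p M" "g \<in> Lp_funs p M"
  shows "(\<lambda>x. f x + g x) \<in> Lp_funs p M"
proof -
  note [measurable] = assms[THEN Lp_measurable]
  have le: "\<bar>a + b\<bar> powr p \<le> 2 powr p * (\<bar>a\<bar> powr p + \<bar>b\<bar> powr p)" for a b :: real
  proof -
    have "\<bar>a + b\<bar> powr p \<le> (2 * max \<bar>a\<bar> \<bar>b\<bar>) powr p"
      using p_pos by (intro powr_mono2) auto
    also have "\<dots> \<le> 2 powr p * (\<bar>a\<bar> powr p + \<bar>b\<bar> powr p)"
      by (simp add: powr_mult max_def)
    finally show ?thesis .
  qed
  have "integrable M (\<lambda>x. \<bar>f x + g x\<bar> powr p)"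
    by (rule Bochner_Integration.integrable_bound
        [of _ "\<lambda>x. 2 powr p * (\<bar>f x\<bar> powr p + \<bar>g x\<bar> powr p)"])
       (use le assms[THEN Lp_integrable] in \<open>auto\<close>)
  then show ?thesis by (simp add: Lp_funs_def)
qed

lemma Lp_diff:
  assumes "f \<in> Lp_funs p M" "g \<in> Lp_funs p M"
  shows "(\<lambda>x. f x - g x) \<in> Lp_funs p M"
  using Lp_add[OF assms(1) Lp_scale[OF assms(2), of "-1"]] by simp

lemma Lp_abs: "f \<in> Lp_funs p M \<Longrightarrow> (\<lambda>x. \<bar>f x\<bar>) \<in> Lp_funs p M"
  by (auto simp: Lp_funs_def)

lemma Lp_max:
  assumes "f \<in> Lp_funs p M" "g \<in> Lp_funs p M"
  shows "(\<lambda>x. max (f x) (g x)) \<in> Lp_funs p M"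
  by (rule Lp_dominated[OF Lp_add[OF Lp_abs[OF assms(1)] Lp_abs[OF assms(2)]]])
     (use assms in auto)

lemma Lp_min:
  assumes "f \<in> Lp_funs p M" "g \<in> Lp_funs p M"
  shows "(\<lambda>x. min (f x) (g x)) \<in> Lp_funs p M"
  by (rule Lp_dominated[OF Lp_add[OF Lp_abs[OF assms(1)] Lp_abs[OF assms(2)]]])
     (use assms in auto)

lemma Lp_restrict:
  assumes "f \<in> Lp_funs p M" "S \<in> sets M"
  shows "(\<lambda>x. indicator S x * f x) \<in> Lp_funs p M"
  by (rule Lp_dominated[OF assms(1)]) (use assms in \<open>auto simp: indicator_def\<close>)

lemma pint_nonneg: "0 \<le> pint f"
  by (simp add: pint_def)

lemma pint_cong_AE:
  assumes "f \<in> borel_measurable M" "g \<in> borel_measurable M" "AE x in M. f x = g x"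
  shows "pint f = pint g"
  unfolding pint_def
  by (rule integral_cong_AE) (use assms in \<open>auto elim: eventually_mono\<close>)

lemma pint_mono:
  assumes "f \<in> Lp_funs p M" "g \<in> Lp_funs p M" "AE x in M. \<bar>f x\<bar> \<le> \<bar>g x\<bar>"
  shows "pint f \<le> pint g"
  unfolding pint_def
proof (rule integral_mono_AE)
  show "AE x in M. \<bar>f x\<bar> powr p \<le> \<bar>g x\<bar> powr p"
    using assms(3) by eventually_elim (use p_pos in \<open>auto intro: powr_mono2\<close>)
qed (use assms Lp_integrable in auto)

lemma pint_scale: "pint (\<lambda>x. a * f x) = \<bar>a\<bar> powr p * pint f"
  by (simp add: pint_def abs_mult powr_mult)

lemma pint_eq_0:
  assumes "f \<in> Lp_funs p M"
  shows "pint f = 0 \<longleftrightarrow> (AE x in M. f x = 0)"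
  using integral_nonneg_eq_0_iff_AE[OF Lp_integrable[OF assms]] by (simp add: pint_def)

lemma nn_integral_eq_pint:
  assumes "f \<in> Lp_funs p M"
  shows "(\<integral>\<^sup>+x. ennreal (\<bar>f x\<bar> powr p) \<partial>M) = ennreal (pint f)"
  unfolding pint_def by (rule nn_integral_eq_integral) (use Lp_integrable[OF assms] in auto)

lemma pnorm_nonneg: "0 \<le> pnorm f"
  by (simp add: pnorm_def)

lemma pnorm_powr: "pnorm f powr p = pint f"
  using p_pos pint_nonneg[of f] by (simp add: pnorm_def powr_powr)

lemma pnorm_le_iff: "0 \<le> c \<Longrightarrow> pnorm f \<le> c \<longleftrightarrow> pint f \<le> c powr p"
  by (metis pnorm_powr pnorm_nonneg p_pos powr_mono2 powr_less_mono2 not_le less_imp_le)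

lemma pnorm_less_iff: "0 \<le> c \<Longrightarrow> pnorm f < c \<longleftrightarrow> pint f < c powr p"
  by (metis pnorm_powr pnorm_nonneg p_pos powr_mono2 powr_less_mono2 not_le less_imp_le)

lemma pnorm_eq_0: "f \<in> Lp_funs p M \<Longrightarrow> pnorm f = 0 \<longleftrightarrow> (AE x in M. f x = 0)"
  using pint_eq_0[of f] by (simp add: pnorm_def)

lemma pnorm_scale: "pnorm (\<lambda>x. a * f x) = \<bar>a\<bar> * pnorm f"
  using p_pos by (simp add: pnorm_def pint_scale powr_mult powr_powr)

text \<open>
  Minkowski's inequality: normalise both summands and write \<open>(f + g) / (\<parallel>f\<parallel> + \<parallel>g\<parallel>)\<close> as a convex
  combination of \<open>f / \<parallel>f\<parallel>\<close> and \<open>g / \<parallel>g\<parallel>\<close>; by convexity its \<open>p\<close>-th power integral is at most \<open>1\<close>.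
\<close>

lemma pnorm_triangle:
  assumes f: "f \<in> Lp_funs p M" and g: "g \<in> Lp_funs p M"
  shows "pnorm (\<lambda>x. f x + g x) \<le> pnorm f + pnorm g"
proof -
  note [measurable] = assms[THEN Lp_measurable]
  have zero: "pnorm (\<lambda>x. u x + v x) \<le> pnorm u + pnorm v"
    if "u \<in> Lp_funs p M" "v \<in> Lp_funs p M" "pnorm u = 0" for u v
  proof -
    have "pint (\<lambda>x. u x + v x) = pint v"
      using that pnorm_eq_0[OF that(1)] by (intro pint_cong_AE) auto
    then show ?thesis using that by (simp add: pnorm_def)
  qed
  consider "pnorm f = 0" | "pnorm g = 0" | "0 < pnorm f" "0 < pnorm g"
    using pnorm_nonneg by (metis less_eq_real_def)
  then show ?thesis
  proof cases
    case 1
    then show ?thesis using zero[OF f g] by simp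
  next
    case 2
    then show ?thesis using zero[OF g f] by (simp add: add.commute)
  next
    case 3
    define a b where "a = pnorm f" and "b = pnorm g"
    define t where "t = b / (a + b)"
    have ab: "0 < a" "0 < b" using 3 by (simp_all add: a_def b_def)
    have t: "0 \<le> t" "t \<le> 1" "1 - t = a / (a + b)"
      using ab by (auto simp: t_def field_simps)
    have unit: "pint (\<lambda>x. f x / a) = 1" "pint (\<lambda>x. g x / b) = 1"
      using ab pint_scale[of "1 / a" f] pint_scale[of "1 / b" g]
      by (simp_all add: a_def b_def powr_divide divide_simps flip: pnorm_powr)
    have fa: "(\<lambda>x. f x / a) \<in> Lp_funs p M" and gb: "(\<lambda>x. g x / b) \<in> Lp_funs p M"
      using Lp_scale[OF f, of "1 / a"] Lp_scale[OF g, of "1 / b"] by simp_all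
    have fg: "(\<lambda>x. (f x + g x) / (a + b)) \<in> Lp_funs p M"
      using Lp_scale[OF Lp_add[OF f g], of "1 / (a + b)"] by simp
    have "pint (\<lambda>x. (f x + g x) / (a + b))
        \<le> (\<integral>x. (1 - t) * \<bar>f x / a\<bar> powr p + t * \<bar>g x / b\<bar> powr p \<partial>M)"
      unfolding pint_def
    proof (rule integral_mono)
      show "\<bar>(f x + g x) / (a + b)\<bar> powr p \<le> (1 - t) * \<bar>f x / a\<bar> powr p + t * \<bar>g x / b\<bar> powr p" for x
      proof -
        have "\<bar>(f x + g x) / (a + b)\<bar> \<le> (1 - t) * \<bar>f x / a\<bar> + t * \<bar>g x / b\<bar>"
          using ab t abs_triangle_ineq[of "f x" "g x"] by (simp add: t_def divide_simps)
        then have "\<bar>(f x + g x) / (a + b)\<bar> powr p \<le> ((1 - t) * \<bar>f x / a\<bar> + t * \<bar>g x / b\<bar>) powr p"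
          using p_pos by (intro powr_mono2) auto
        also have "\<dots> \<le> (1 - t) * \<bar>f x / a\<bar> powr p + t * \<bar>g x / b\<bar> powr p"
          using t one_le_p by (intro powr_convex_combination) auto
        finally show ?thesis .
      qed
    qed (use Lp_integrable[OF fa] Lp_integrable[OF gb] Lp_integrable[OF fg] in auto)
    also have "\<dots> = (1 - t) * pint (\<lambda>x. f x / a) + t * pint (\<lambda>x. g x / b)"
      using Lp_integrable[OF fa] Lp_integrable[OF gb] by (simp add: pint_def)
    also have "\<dots> = 1" by (simp add: unit)
    finally have "pnorm (\<lambda>x. (f x + g x) / (a + b)) \<le> 1"
      by (simp add: pnorm_le_iff)
    then show ?thesis
      using pnorm_scale[of "1 / (a + b)" "\<lambda>x. f x + g x"] ab by (simp add: a_def b_def)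
  qed
qed

text \<open>
  Riesz--Fischer. A subsequence whose successive differences are small in norm even after
  multiplication by \<open>2 ^ k\<close> has absolutely summable increments at almost every point, hence
  converges there.
\<close>

lemma pnorm_complete:
  assumes f: "\<And>j. f j \<in> Lp_funs p M"
    and cauchy: "\<And>e. 0 < e \<Longrightarrow> \<exists>N. \<forall>i\<ge>N. \<forall>j\<ge>N. pnorm (\<lambda>x. f i x - f j x) < e"
  shows "\<exists>g\<in>Lp_funs p M. (\<lambda>j. pnorm (\<lambda>x. f j x - g x)) \<longlonglongrightarrow> 0"
proof -
  note [measurable] = f[THEN Lp_measurable]
  have cauchy': "\<exists>N. \<forall>i\<ge>N. \<forall>j\<ge>N. pint (\<lambda>x. f i x - f j x) < e" if "0 < e" for e
    using cauchy[of "e powr (1 / p)"] that p_pos by (simp add: pnorm_less_iff powr_powr)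
  \<comment> \<open>The second factor absorbs the weight \<open>2 ^ k\<close> in the \<open>p\<close>-th power, the first gives summability.\<close>
  define d where "d k = (1/2) ^ k * ((1/2) ^ k) powr p" for k :: nat
  have d_pos: "0 < d k" for k by (simp add: d_def)
  obtain r where r: "strict_mono r"
    and r_d: "\<And>k i j. i \<ge> r k \<Longrightarrow> j \<ge> r k \<Longrightarrow> pint (\<lambda>x. f i x - f j x) < d k"
  proof -
    have "\<exists>r. \<forall>k. (\<forall>i\<ge>r k. \<forall>j\<ge>r k. pint (\<lambda>x. f i x - f j x) < d k) \<and> r k < r (Suc k)"
    proof (rule dependent_nat_choice)
      fix m k :: nat
      obtain N where "\<forall>i\<ge>N. \<forall>j\<ge>N. pint (\<lambda>x. f i x - f j x) < d (Suc k)"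
        using cauchy'[OF d_pos] by blast
      then show "\<exists>y. (\<forall>i\<ge>y. \<forall>j\<ge>y. pint (\<lambda>x. f i x - f j x) < d (Suc k)) \<and> m < y"
        by (intro exI[of _ "max N (Suc m)"]) auto
    qed (use cauchy'[OF d_pos] in blast)
    then show ?thesis using that by (auto simp: strict_mono_Suc_iff)
  qed
  define D where "D k x = 2 ^ k * (f (r (Suc k)) x - f (r k) x)" for k x
  have D: "D k \<in> Lp_funs p M" for k
    unfolding D_def by (intro Lp_scale Lp_diff f)
  note [measurable] = D[THEN Lp_measurable]
  have pint_D: "pint (D k) \<le> (1/2) ^ k" for k
  proof -
    have "pint (D k) = (2 ^ k) powr p * pint (\<lambda>x. f (r (Suc k)) x - f (r k) x)"
      unfolding D_def by (simp add: pint_scale)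
    also have "\<dots> \<le> (2 ^ k) powr p * d k"
      using r_d[of k "r (Suc k)" "r k"] strict_monoD[OF r, of k "Suc k"]
      by (intro mult_left_mono) auto
    also have "\<dots> = (1/2) ^ k"
      by (simp add: d_def power_divide powr_divide)
    finally show ?thesis .
  qed
  have "AE x in M. (\<Sum>k. ennreal (\<bar>D k x\<bar> powr p)) \<noteq> \<infinity>"
  proof (rule nn_integral_PInf_AE)
    have "(\<integral>\<^sup>+x. (\<Sum>k. ennreal (\<bar>D k x\<bar> powr p)) \<partial>M) = (\<Sum>k. ennreal (pint (D k)))"
      by (simp add: nn_integral_suminf nn_integral_eq_pint[OF D])
    also have "\<dots> \<le> (\<Sum>k. ennreal ((1/2) ^ k))"
      using pint_D by (intro suminf_le) (auto intro: ennreal_leI)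
    also have "\<dots> = ennreal (\<Sum>k. (1/2) ^ k)"
      by (intro suminf_ennreal2) auto
    finally show "(\<integral>\<^sup>+x. (\<Sum>k. ennreal (\<bar>D k x\<bar> powr p)) \<partial>M) \<noteq> \<infinity>"
      by (auto simp: top_unique)
  qed auto
  then have conv: "AE x in M. convergent (\<lambda>k. f (r k) x)"
  proof eventually_elim
    fix x assume "(\<Sum>k. ennreal (\<bar>D k x\<bar> powr p)) \<noteq> \<infinity>"
    then have "summable (\<lambda>k. \<bar>D k x\<bar> powr p)"
      by (intro summable_suminf_not_top) auto
    then have "eventually (\<lambda>k. \<bar>D k x\<bar> powr p < 1) sequentially"
      using summable_LIMSEQ_zero order_tendstoD(2) by (metis zero_less_one)
    then have "eventually (\<lambda>k. norm (f (r (Suc k)) x - f (r k) x) \<le> (1/2) ^ k) sequentially"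
    proof eventually_elim
      case (elim k)
      then have "\<bar>D k x\<bar> \<le> 1"
        using p_pos ge_one_powr_ge_zero[of "\<bar>D k x\<bar>" p] by linarith
      moreover have "\<bar>D k x\<bar> = 2 ^ k * \<bar>f (r (Suc k)) x - f (r k) x\<bar>"
        by (simp add: D_def abs_mult)
      ultimately show ?case by (simp add: power_divide pos_le_divide_eq mult.commute)
    qed
    then have "summable (\<lambda>k. f (r (Suc k)) x - f (r k) x)"
      by (rule summable_comparison_test_ev) simp
    then have "convergent (\<lambda>n. f (r n) x - f (r 0) x)"
      by (simp add: summable_iff_convergent sum_lessThan_telescope[where f = "\<lambda>n. f (r n) x"])
    then have "convergent (\<lambda>n. (f (r n) x - f (r 0) x) + f (r 0) x)"
      by (intro convergent_add convergent_const)
    then show "convergent (\<lambda>k. f (r k) x)" by simp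
  qed
  define g where "g x = lim (\<lambda>k. f (r k) x)" for x
  have [measurable]: "g \<in> borel_measurable M"
    unfolding g_def by measurable
  \<comment> \<open>Fatou's lemma along the subsequence bounds the distance of every late term to the limit.\<close>
  have close: "(\<integral>\<^sup>+x. ennreal (\<bar>f i x - g x\<bar> powr p) \<partial>M) \<le> ennreal e"
    if N: "\<forall>i\<ge>N. \<forall>j\<ge>N. pint (\<lambda>x. f i x - f j x) < e" and "i \<ge> N" for e N i
  proof -
    have "(\<integral>\<^sup>+x. ennreal (\<bar>f i x - g x\<bar> powr p) \<partial>M)
        = (\<integral>\<^sup>+x. liminf (\<lambda>k. ennreal (\<bar>f i x - f (r k) x\<bar> powr p)) \<partial>M)"
    proof (rule nn_integral_cong_AE)
      show "AE x in M. ennreal (\<bar>f i x - g x\<bar> powr p)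
          = liminf (\<lambda>k. ennreal (\<bar>f i x - f (r k) x\<bar> powr p))"
        using conv
      proof eventually_elim
        case (elim x)
        then have "(\<lambda>k. f (r k) x) \<longlonglongrightarrow> g x"
          by (simp add: g_def convergent_LIMSEQ_iff)
        then have "(\<lambda>k. ennreal (\<bar>f i x - f (r k) x\<bar> powr p))
            \<longlonglongrightarrow> ennreal (\<bar>f i x - g x\<bar> powr p)"
          using p_pos by (intro tendsto_ennrealI tendsto_powr' tendsto_intros) auto
        then show ?case by (intro lim_imp_Liminf[symmetric]) auto
      qed
    qed
    also have "\<dots> \<le> liminf (\<lambda>k. \<integral>\<^sup>+x. ennreal (\<bar>f i x - f (r k) x\<bar> powr p) \<partial>M)"
      by (rule nn_integral_liminf) measurable
    also have "\<dots> \<le> liminf (\<lambda>k. ennreal e)"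
    proof (rule Liminf_mono)
      show "eventually (\<lambda>k. (\<integral>\<^sup>+x. ennreal (\<bar>f i x - f (r k) x\<bar> powr p) \<partial>M) \<le> ennreal e) sequentially"
        using eventually_ge_at_top[of N]
      proof eventually_elim
        case (elim k)
        then have "r k \<ge> N" using seq_suble[OF r, of k] by linarith
        then show ?case
          using N \<open>i \<ge> N\<close> nn_integral_eq_pint[OF Lp_diff[OF f f]]
          by (simp add: ennreal_leI less_imp_le)
      qed
    qed
    finally show ?thesis by (simp add: Liminf_const)
  qed
  have fg: "(\<lambda>x. f i x - g x) \<in> Lp_funs p M"
    if "\<forall>i\<ge>N. \<forall>j\<ge>N. pint (\<lambda>x. f i x - f j x) < e" "i \<ge> N" for e N i
    using le_less_trans[OF close[OF that] ennreal_less_top]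
    by (auto simp: Lp_funs_def intro!: integrableI_bounded)
  obtain N where N: "\<forall>i\<ge>N. \<forall>j\<ge>N. pint (\<lambda>x. f i x - f j x) < 1"
    using cauchy'[of 1] by auto
  have g: "g \<in> Lp_funs p M"
    using Lp_diff[OF f[of N] fg[OF N order_refl]] by simp
  moreover have "(\<lambda>j. pnorm (\<lambda>x. f j x - g x)) \<longlonglongrightarrow> 0"
  proof (rule LIMSEQ_I)
    fix e :: real assume "0 < e"
    then have "0 < (e / 2) powr p" by simp
    from cauchy'[OF this] obtain N
      where N: "\<forall>i\<ge>N. \<forall>j\<ge>N. pint (\<lambda>x. f i x - f j x) < (e / 2) powr p" by blast
    have "norm (pnorm (\<lambda>x. f i x - g x) - 0) < e" if "i \<ge> N" for i
    proof -
      have "pint (\<lambda>x. f i x - g x) \<le> (e / 2) powr p"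
        using close[OF N that] nn_integral_eq_pint[OF fg[OF N that]] by simp
      then have "pnorm (\<lambda>x. f i x - g x) \<le> e / 2"
        using \<open>0 < e\<close> pnorm_le_iff[of "e / 2"] by simp
      then show ?thesis using \<open>0 < e\<close> pnorm_nonneg by simp
    qed
    then show "\<exists>N. \<forall>i\<ge>N. norm (pnorm (\<lambda>x. f i x - g x) - 0) < e" by blast
  qed
  ultimately show ?thesis by blast
qed

section \<open>The Banach lattice of almost-everywhere classes\<close>

definition cls :: "('a \<Rightarrow> real) \<Rightarrow> ('a \<Rightarrow> real) set" where
  "cls f = Lp_rel p M `` {f}"

lemma mem_cls: "f \<in> Lp_funs p M \<Longrightarrow> g \<in> cls f \<longleftrightarrow> g \<in> Lp_funs p M \<and> (AE x in M. f x = g x)"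
  by (auto simp: cls_def Lp_rel_def)

lemma self_in_cls: "f \<in> Lp_funs p M \<Longrightarrow> f \<in> cls f"
  by (simp add: mem_cls)

lemma cls_eqI:
  assumes "f \<in> Lp_funs p M" "g \<in> Lp_funs p M" "AE x in M. f x = g x"
  shows "cls f = cls g"
proof -
  have "(AE x in M. f x = h x) \<longleftrightarrow> (AE x in M. g x = h x)" for h
    using assms(3) by (intro eventually_cong) (auto elim: eventually_mono)
  then show ?thesis using assms by (auto simp: mem_cls)
qed

lemma cls_eq_iff:
  assumes "f \<in> Lp_funs p M" "g \<in> Lp_funs p M"
  shows "cls f = cls g \<longleftrightarrow> (AE x in M. f x = g x)"
  using assms cls_eqI[OF assms] self_in_cls[OF assms(2)] mem_cls[OF assms(1)] by blast

lemma carrier_Lp: "vcarrier (Lp p M) = cls ` Lp_funs p M"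
  by (auto simp: Lp_def quotient_def cls_def)

lemma zero_Lp: "vzero (Lp p M) = cls (\<lambda>_. 0)"
  by (simp add: Lp_def cls_def)

lemma add_Lp:
  assumes "f \<in> Lp_funs p M" "g \<in> Lp_funs p M"
  shows "vadd (Lp p M) (cls f) (cls g) = cls (\<lambda>x. f x + g x)"
proof -
  have "cls (\<lambda>x. f' x + g' x) = cls (\<lambda>x. f x + g x)" if "f' \<in> cls f" "g' \<in> cls g" for f' g'
    using that assms by (intro cls_eqI Lp_add) (auto simp: mem_cls)
  then have "(\<Union>f'\<in>cls f. \<Union>g'\<in>cls g. cls (\<lambda>x. f' x + g' x)) = cls (\<lambda>x. f x + g x)"
    using assms self_in_cls by blast
  then show ?thesis by (simp add: Lp_def cls_def)
qed

lemma scale_Lp: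
  assumes "f \<in> Lp_funs p M"
  shows "vscale (Lp p M) a (cls f) = cls (\<lambda>x. a * f x)"
proof -
  have "cls (\<lambda>x. a * f' x) = cls (\<lambda>x. a * f x)" if "f' \<in> cls f" for f'
    using that assms by (intro cls_eqI[symmetric] Lp_scale) (auto simp: mem_cls)
  then have "(\<Union>f'\<in>cls f. cls (\<lambda>x. a * f' x)) = cls (\<lambda>x. a * f x)"
    using assms self_in_cls by blast
  then show ?thesis by (simp add: Lp_def cls_def)
qed

lemma neg_Lp: "f \<in> Lp_funs p M \<Longrightarrow> vneg (Lp p M) (cls f) = cls (\<lambda>x. - f x)"
  by (simp add: vneg_def scale_Lp)

lemma diff_Lp:
  assumes "f \<in> Lp_funs p M" "g \<in> Lp_funs p M"
  shows "vdiff (Lp p M) (cls f) (cls g) = cls (\<lambda>x. f x - g x)"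
  using add_Lp[OF assms(1) Lp_scale[OF assms(2), of "-1"]] by (simp add: vdiff_def neg_Lp assms)

lemma le_Lp:
  assumes "f \<in> Lp_funs p M" "g \<in> Lp_funs p M"
  shows "vle (Lp p M) (cls f) (cls g) \<longleftrightarrow> (AE x in M. f x \<le> g x)"
proof -
  have "AE x in M. f x \<le> g x" if "f' \<in> cls f" "g' \<in> cls g" "AE x in M. f' x \<le> g' x" for f' g'
  proof -
    have "AE x in M. f x = f' x" "AE x in M. g x = g' x"
      using that assms by (auto simp: mem_cls)
    with that(3) show ?thesis by eventually_elim simp
  qed
  then show ?thesis
    using self_in_cls[OF assms(1)] self_in_cls[OF assms(2)]
    by (simp add: Lp_def) blast
qed

lemma norm_Lp:
  assumes "f \<in> Lp_funs p M"
  shows "vnorm (Lp p M) (cls f) = pnorm f"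
proof -
  have "pnorm g = pnorm f" if "g \<in> cls f" for g
    using that assms pint_cong_AE[of f g] by (auto simp: mem_cls pnorm_def)
  then have "pnorm ` cls f = {pnorm f}"
    using self_in_cls[OF assms] by blast
  moreover have "vnorm (Lp p M) = (\<lambda>X. the_elem (pnorm ` X))"
    by (simp add: Lp_def fun_eq_iff pnorm_def pint_def image_def)
  ultimately show ?thesis by simp
qed

lemma sup_Lp:
  assumes f: "f \<in> Lp_funs p M" and g: "g \<in> Lp_funs p M"
  shows "is_vsup (Lp p M) (cls f) (cls g) (cls (\<lambda>x. max (f x) (g x)))"
  using assms by (auto simp: is_vsup_def carrier_Lp le_Lp Lp_max)

lemma inf_Lp:
  assumes f: "f \<in> Lp_funs p M" and g: "g \<in> Lp_funs p M"
  shows "is_vinf (Lp p M) (cls f) (cls g) (cls (\<lambda>x. min (f x) (g x)))"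
  using assms by (auto simp: is_vinf_def carrier_Lp le_Lp Lp_min)

lemma le_Lp_antisym:
  assumes "X \<in> vcarrier (Lp p M)" "Y \<in> vcarrier (Lp p M)" "vle (Lp p M) X Y" "vle (Lp p M) Y X"
  shows "X = Y"
proof -
  obtain f g where f: "f \<in> Lp_funs p M" "X = cls f" and g: "g \<in> Lp_funs p M" "Y = cls g"
    using assms(1,2) by (auto simp: carrier_Lp)
  with assms(3,4) have "AE x in M. f x \<le> g x" "AE x in M. g x \<le> f x"
    by (simp_all add: le_Lp)
  then have "AE x in M. f x = g x" by eventually_elim simp
  then show ?thesis using f g by (simp add: cls_eq_iff)
qed

lemma abs_Lp:
  assumes f: "f \<in> Lp_funs p M"
  shows "vabs (Lp p M) (cls f) = cls (\<lambda>x. \<bar>f x\<bar>)"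
proof -
  have "(\<lambda>x. max (f x) (- f x)) = (\<lambda>x. \<bar>f x\<bar>)" by auto
  then have sup: "is_vsup (Lp p M) (cls f) (vneg (Lp p M) (cls f)) (cls (\<lambda>x. \<bar>f x\<bar>))"
    using sup_Lp[OF f Lp_scale[OF f, of "-1"]] f by (simp add: neg_Lp)
  moreover have "s = cls (\<lambda>x. \<bar>f x\<bar>)" if "is_vsup (Lp p M) (cls f) (vneg (Lp p M) (cls f)) s" for s
    by (rule le_Lp_antisym) (use sup that in \<open>simp_all add: is_vsup_def\<close>)
  ultimately show ?thesis unfolding vabs_def by (rule the_equality)
qed

lemma banach_lattice_Lp: "banach_lattice (Lp p M)"
proof -
  note ops = add_Lp scale_Lp neg_Lp le_Lp norm_Lp zero_Lp abs_Lp Lp_add Lp_scale Lp_zero Lp_abs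
  have real_vector: "real_vector_structure (Lp p M)"
  proof
    show "vadd (Lp p M) X (vneg (Lp p M) X) = vzero (Lp p M)" if "X \<in> vcarrier (Lp p M)" for X
      using that diff_Lp by (auto simp: carrier_Lp ops simp flip: vdiff_def)
  qed (auto simp: carrier_Lp ops algebra_simps)
  have banach: "banach_structure (Lp p M)"
  proof (intro banach_structure.intro real_vector banach_structure_axioms.intro)
    fix s
    assume s: "\<And>j::nat. s j \<in> vcarrier (Lp p M)"
      and cauchy: "\<And>e. 0 < e \<Longrightarrow>
        \<exists>N. \<forall>i\<ge>N. \<forall>j\<ge>N. vnorm (Lp p M) (vdiff (Lp p M) (s i) (s j)) < e"
    obtain f where f: "\<And>j. f j \<in> Lp_funs p M" "\<And>j. s j = cls (f j)"
      using s by (auto simp: carrier_Lp image_iff) metis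
    have "\<exists>g\<in>Lp_funs p M. (\<lambda>j. pnorm (\<lambda>x. f j x - g x)) \<longlonglongrightarrow> 0"
      using cauchy by (intro pnorm_complete f(1)) (simp add: f diff_Lp norm_Lp Lp_diff)
    then show "\<exists>l\<in>vcarrier (Lp p M). (\<lambda>j. vnorm (Lp p M) (vdiff (Lp p M) (s j) l)) \<longlonglongrightarrow> 0"
      by (auto simp: carrier_Lp f diff_Lp norm_Lp Lp_diff)
  next
    show "vnorm (Lp p M) X = 0 \<longleftrightarrow> X = vzero (Lp p M)" if "X \<in> vcarrier (Lp p M)" for X
      using that unfolding carrier_Lp by (elim imageE) (simp add: ops pnorm_eq_0 cls_eq_iff)
  qed (auto simp: carrier_Lp ops pnorm_scale pnorm_triangle)
  show ?thesis
  proof (intro banach_lattice.intro banach banach_lattice_axioms.intro)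
    fix X Y Z assume "X \<in> vcarrier (Lp p M)" "Y \<in> vcarrier (Lp p M)" "Z \<in> vcarrier (Lp p M)"
      "vle (Lp p M) X Y" "vle (Lp p M) Y Z"
    then show "vle (Lp p M) X Z"
      by (auto simp: carrier_Lp ops elim: eventually_elim2)
  next
    fix X Y :: "('a \<Rightarrow> real) set" and a :: real
    assume "X \<in> vcarrier (Lp p M)" "Y \<in> vcarrier (Lp p M)" "0 \<le> a" "vle (Lp p M) X Y"
    then show "vle (Lp p M) (vscale (Lp p M) a X) (vscale (Lp p M) a Y)"
      by (auto simp: carrier_Lp ops elim!: eventually_mono intro: mult_left_mono)
  next
    fix X Y assume "X \<in> vcarrier (Lp p M)" "Y \<in> vcarrier (Lp p M)"
      "vle (Lp p M) (vabs (Lp p M) X) (vabs (Lp p M) Y)"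
    then show "vnorm (Lp p M) X \<le> vnorm (Lp p M) Y"
      by (auto simp: carrier_Lp ops pnorm_def intro!: powr_mono2 pint_mono pint_nonneg less_imp_le[OF p_pos])
  next
    show "X = Y" if "X \<in> vcarrier (Lp p M)" "Y \<in> vcarrier (Lp p M)"
      "vle (Lp p M) X Y" "vle (Lp p M) Y X" for X Y
      using that by (rule le_Lp_antisym)
  qed (auto simp: carrier_Lp ops intro: sup_Lp inf_Lp)
qed

end

section \<open>Sums of powers of positive functionals\<close>

lemma abs_prod_le_sum_powers:
  fixes a :: "nat \<Rightarrow> real"
  assumes "0 < n"
  shows "\<bar>\<Prod>i<n. a i\<bar> \<le> (\<Sum>i<n. \<bar>a i\<bar> ^ n)"
proof -
  define m where "m = Max ((\<lambda>i. \<bar>a i\<bar>) ` {..<n})"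
  have "m \<in> (\<lambda>i. \<bar>a i\<bar>) ` {..<n}"
    unfolding m_def using assms by (intro Max_in) auto
  then obtain j where j: "j < n" "m = \<bar>a j\<bar>" by auto
  have "\<bar>\<Prod>i<n. a i\<bar> \<le> (\<Prod>i<n. m)"
    unfolding abs_prod by (intro prod_mono) (auto simp: m_def)
  also have "\<dots> = \<bar>a j\<bar> ^ n" by (simp add: j)
  also have "\<dots> \<le> (\<Sum>i<n. \<bar>a i\<bar> ^ n)"
    using j(1) by (intro member_le_sum) auto
  finally show ?thesis .
qed

text \<open>
  The polarisation of \<open>\<Sum>k. \<phi> k x ^ n\<close> is \<open>\<Sum>k. \<Prod>i<n. \<phi> k (v i)\<close>; bounding a product by the sum of
  the \<open>n\<close>-th powers of its factors shows that it converges wherever the diagonal sums do.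
\<close>

lemma regular_poly_sum_of_powers:
  assumes "0 < n"
    and lin: "\<And>k::nat. linear_functional E (\<phi> k)"
    and pos: "\<And>k x. x \<in> vcarrier E \<Longrightarrow> vle E (vzero E) x \<Longrightarrow> 0 \<le> \<phi> k x"
    and summ: "\<And>x. x \<in> vcarrier E \<Longrightarrow> summable (\<lambda>k. \<bar>\<phi> k x\<bar> ^ n)"
  shows "regular_poly n E (\<lambda>x. \<Sum>k. \<phi> k x ^ n)"
proof -
  define A where "A v = (\<Sum>k. \<Prod>i<n. \<phi> k (v i))" for v
  have summ_prod: "summable (\<lambda>k. \<Prod>i<n. \<phi> k (v i))" if "\<And>i. i < n \<Longrightarrow> v i \<in> vcarrier E" for v
  proof (rule summable_comparison_test')
    show "summable (\<lambda>k. \<Sum>i<n. \<bar>\<phi> k (v i)\<bar> ^ n)"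
      using that summ by (intro summable_sum) auto
    show "norm (\<Prod>i<n. \<phi> k (v i)) \<le> (\<Sum>i<n. \<bar>\<phi> k (v i)\<bar> ^ n)" for k
      using abs_prod_le_sum_powers[OF \<open>0 < n\<close>, of "\<lambda>i. \<phi> k (v i)"] by simp
  qed
  have slot: "(\<Prod>j<n. \<phi> k ((v(i := x)) j)) = \<phi> k x * (\<Prod>j\<in>{..<n} - {i}. \<phi> k (v j))"
    if "i < n" for k v i x
  proof -
    have "(\<Prod>j<n. \<phi> k ((v(i := x)) j))
        = \<phi> k ((v(i := x)) i) * (\<Prod>j\<in>{..<n} - {i}. \<phi> k ((v(i := x)) j))"
      using that by (intro prod.remove) auto
    also have "(\<Prod>j\<in>{..<n} - {i}. \<phi> k ((v(i := x)) j)) = (\<Prod>j\<in>{..<n} - {i}. \<phi> k (v j))"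
      by (intro prod.cong) auto
    finally show ?thesis by simp
  qed
  have "symmetric_multilinear n E A"
    unfolding symmetric_multilinear_def
  proof (intro conjI ballI allI impI)
    fix v i assume v: "v \<in> tuples n E" and i: "i < n"
    have summ_slot: "summable (\<lambda>k. \<phi> k x * (\<Prod>j\<in>{..<n} - {i}. \<phi> k (v j)))"
      if "x \<in> vcarrier E" for x
    proof -
      have "(v(i := x)) j \<in> vcarrier E" if "j < n" for j
        using v \<open>x \<in> vcarrier E\<close> that by (auto simp: tuples_def)
      from summ_prod[of "v(i := x)", OF this] show ?thesis unfolding slot[OF i] .
    qed
    show "linear_functional E (\<lambda>x. A (v(i := x)))"
      unfolding linear_functional_def A_def slot[OF i]
    proof (intro conjI ballI allI)
      fix x y assume "x \<in> vcarrier E" "y \<in> vcarrier E"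
      with lin show "(\<Sum>k. \<phi> k (vadd E x y) * (\<Prod>j\<in>{..<n} - {i}. \<phi> k (v j)))
          = (\<Sum>k. \<phi> k x * (\<Prod>j\<in>{..<n} - {i}. \<phi> k (v j)))
            + (\<Sum>k. \<phi> k y * (\<Prod>j\<in>{..<n} - {i}. \<phi> k (v j)))"
        by (subst suminf_add) (auto simp: linear_functional_def distrib_right intro!: summ_slot)
    next
      fix a x assume "x \<in> vcarrier E"
      with lin show "(\<Sum>k. \<phi> k (vscale E a x) * (\<Prod>j\<in>{..<n} - {i}. \<phi> k (v j)))
          = a * (\<Sum>k. \<phi> k x * (\<Prod>j\<in>{..<n} - {i}. \<phi> k (v j)))"
        by (subst suminf_mult[symmetric])
           (auto simp: linear_functional_def mult.assoc intro!: summ_slot)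
    qed
  next
    fix v \<pi> assume perm: "\<pi> permutes {..<n}"
    have "(\<Prod>i<n. \<phi> k ((v \<circ> \<pi>) i)) = (\<Prod>i<n. \<phi> k (v i))" for k
      using prod.permute[OF perm, of "\<lambda>i. \<phi> k (v i)"] by (simp add: comp_def)
    then show "A (v \<circ> \<pi>) = A v"
      by (simp add: A_def)
  qed
  then have form: "poly_of_form n E A (\<lambda>x. \<Sum>k. \<phi> k x ^ n)"
    by (simp add: poly_of_form_def A_def)
  moreover have "0 \<le> A v" if "v \<in> tuples n E" "\<forall>i<n. vle E (vzero E) (v i)" for v
    unfolding A_def using that
    by (intro suminf_nonneg summ_prod prod_nonneg) (auto simp: tuples_def intro!: pos)
  ultimately have "positive_poly n E (\<lambda>x. \<Sum>k. \<phi> k x ^ n)"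
    unfolding positive_poly_def by blast
  moreover have "positive_poly n E (\<lambda>_. 0)"
    unfolding positive_poly_def poly_of_form_def symmetric_multilinear_def linear_functional_def
    by (intro exI[of _ "\<lambda>_. 0"]) auto
  ultimately show ?thesis
    unfolding regular_poly_def homogeneous_poly_def using form by fastforce
qed

section \<open>Sparse subsequences\<close>

text \<open>
  Each new index is taken so large that its entries against all indices up to the current one, and
  not only against the chosen ones, are small. Every choice then needs only the current index
  and its position.
\<close>

lemma subsequence_with_small_pairings:
  fixes a :: "nat \<Rightarrow> nat \<Rightarrow> real"
  assumes null: "\<And>i. a i \<longlonglongrightarrow> 0" and "infinite J" and "0 < \<eta>"
  obtains r where "strict_mono r" "\<And>k. r k \<in> J"
    "\<And>i k. i < k \<Longrightarrow> a (r i) (r k) < \<eta> * (1/2) ^ (i + k)"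
proof -
  have "\<exists>r. \<forall>k. r k \<in> J \<and> (r k < r (Suc k) \<and> (\<forall>i\<le>r k. a i (r (Suc k)) < \<eta> * (1/2) ^ (2 * k + 1)))"
  proof (rule dependent_nat_choice)
    show "\<exists>m. m \<in> J" using \<open>infinite J\<close> by (metis finite.emptyI ex_in_conv)
  next
    fix m k
    have "eventually (\<lambda>j. a i j < \<eta> * (1/2) ^ (2 * k + 1)) sequentially" for i
      using \<open>0 < \<eta>\<close> by (intro order_tendstoD(2)[OF null]) auto
    then have "eventually (\<lambda>j. \<forall>i\<in>{..m}. a i j < \<eta> * (1/2) ^ (2 * k + 1)) sequentially"
      by (intro eventually_ball_finite) auto
    then obtain N where N: "\<And>j. j \<ge> N \<Longrightarrow> \<forall>i\<in>{..m}. a i j < \<eta> * (1/2) ^ (2 * k + 1)"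
      by (auto simp: eventually_sequentially)
    obtain j where "j \<in> J" "max N m < j"
      using \<open>infinite J\<close> unfolding infinite_nat_iff_unbounded by blast
    with N[of j] show "\<exists>j. j \<in> J \<and> (m < j \<and> (\<forall>i\<le>m. a i j < \<eta> * (1/2) ^ (2 * k + 1)))"
      by auto
  qed
  then obtain r where r: "\<And>k. r k \<in> J" "\<And>k. r k < r (Suc k)"
    and small: "\<And>k i. i \<le> r k \<Longrightarrow> a i (r (Suc k)) < \<eta> * (1/2) ^ (2 * k + 1)" by blast
  have mono: "strict_mono r" using r(2) by (simp add: strict_mono_Suc_iff)
  moreover have "a (r i) (r k) < \<eta> * (1/2) ^ (i + k)" if "i < k" for i k
  proof -
    obtain l where k: "k = Suc l" using \<open>i < k\<close> by (cases k) auto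
    then have "i \<le> l" using that by simp
    then have "a (r i) (r k) < \<eta> * (1/2) ^ (2 * l + 1)"
      using small[of "r i" l] monoD[OF strict_mono_mono[OF mono]] k by simp
    also have "\<dots> \<le> \<eta> * (1/2) ^ (i + k)"
      using \<open>0 < \<eta>\<close> \<open>i \<le> l\<close> k by (intro mult_left_mono power_decreasing) auto
    finally show ?thesis .
  qed
  ultimately show thesis using that r(1) by blast
qed

context lebesgue_exponent
begin

section \<open>Functionals given by powers of functions\<close>

text \<open>
  The functional \<open>f \<mapsto> \<integral> f * \<bar>F\<bar> powr (p - 1)\<close>, evaluated at an arbitrary representative. The
  weight \<open>\<bar>F\<bar> powr (p - 1)\<close> belongs to the dual space of \<open>L\<^sub>p\<close>; for \<open>p = 1\<close> it is the
  indicator of the support of \<open>F\<close>, as \<open>0 powr 0 = 0\<close>.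
\<close>

definition pairing :: "('a \<Rightarrow> real) \<Rightarrow> ('a \<Rightarrow> real) set \<Rightarrow> real" where
  "pairing F X = (\<integral>x. (SOME f. f \<in> X) x * \<bar>F x\<bar> powr (p - 1) \<partial>M)"

lemma pairing_cls:
  assumes "f \<in> Lp_funs p M" "F \<in> Lp_funs p M"
  shows "pairing F (cls f) = (\<integral>x. f x * \<bar>F x\<bar> powr (p - 1) \<partial>M)"
proof -
  have "(SOME g. g \<in> cls f) \<in> cls f"
    using self_in_cls[OF assms(1)] by (rule someI[of "\<lambda>g. g \<in> cls f"])
  then have *: "(SOME g. g \<in> cls f) \<in> Lp_funs p M" "AE x in M. f x = (SOME g. g \<in> cls f) x"
    using mem_cls[OF assms(1)] by simp_all
  note [measurable] = *(1)[THEN Lp_measurable] assms[THEN Lp_measurable]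
  show ?thesis unfolding pairing_def
    by (rule integral_cong_AE) (use *(2) in \<open>auto elim!: eventually_mono\<close>)
qed

lemma integrable_pairing:
  assumes "f \<in> Lp_funs p M" "F \<in> Lp_funs p M"
  shows "integrable M (\<lambda>x. f x * \<bar>F x\<bar> powr (p - 1))"
proof (rule Bochner_Integration.integrable_bound)
  note [measurable] = assms[THEN Lp_measurable]
  show "integrable M (\<lambda>x. \<bar>f x\<bar> powr p + \<bar>F x\<bar> powr p)"
    using assms by (intro Bochner_Integration.integrable_add Lp_integrable)
  show "(\<lambda>x. f x * \<bar>F x\<bar> powr (p - 1)) \<in> borel_measurable M" by measurable
  show "AE x in M. norm (f x * \<bar>F x\<bar> powr (p - 1)) \<le> norm (\<bar>f x\<bar> powr p + \<bar>F x\<bar> powr p)"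
    using mult_powr_minus_one_le[OF one_le_p] by (auto simp: abs_mult)
qed

lemma linear_pairing:
  assumes "F \<in> Lp_funs p M"
  shows "linear_functional (Lp p M) (pairing F)"
  unfolding linear_functional_def carrier_Lp
  using integrable_pairing[OF _ assms]
  by (auto simp: add_Lp scale_Lp pairing_cls Lp_add Lp_scale assms distrib_right mult.assoc)

lemma pairing_nonneg:
  assumes "F \<in> Lp_funs p M" "X \<in> vcarrier (Lp p M)" "vle (Lp p M) (vzero (Lp p M)) X"
  shows "0 \<le> pairing F X"
proof -
  obtain f where f: "f \<in> Lp_funs p M" "X = cls f"
    using assms(2) by (auto simp: carrier_Lp)
  then have "AE x in M. 0 \<le> f x"
    using assms(3) by (simp add: zero_Lp le_Lp Lp_zero)
  then show ?thesis
    unfolding f(2) pairing_cls[OF f(1) assms(1)]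
    by (intro integral_nonneg_AE) (auto elim: eventually_mono)
qed

text \<open>
  Boundedness of the pairing, by scaling \<open>f\<close> to norm one and applying the crude Young inequality
  pointwise.
\<close>

lemma abs_pairing_le:
  assumes f: "f \<in> Lp_funs p M" and F: "F \<in> Lp_funs p M"
  shows "\<bar>pairing F (cls f)\<bar> \<le> (1 + pint F) * pnorm f"
proof (cases "pnorm f = 0")
  case True
  then have "AE x in M. f x * \<bar>F x\<bar> powr (p - 1) = 0"
    using pnorm_eq_0[OF f] by (auto elim: eventually_mono)
  then show ?thesis
    using True by (simp add: pairing_cls[OF f F] integral_eq_zero_AE)
next
  case False
  define a where "a = pnorm f"
  have a: "0 < a" using False pnorm_nonneg[of f] by (simp add: a_def)
  have *: "(\<lambda>x. f x / a) \<in> Lp_funs p M"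
    using Lp_scale[OF f, of "1 / a"] by simp
  have unit: "pint (\<lambda>x. f x / a) = 1"
    using a pint_scale[of "1 / a" f] by (simp add: a_def powr_divide divide_simps flip: pnorm_powr)
  have "\<bar>\<integral>x. f x / a * \<bar>F x\<bar> powr (p - 1) \<partial>M\<bar> \<le> (\<integral>x. \<bar>f x / a * \<bar>F x\<bar> powr (p - 1)\<bar> \<partial>M)"
    by (rule integral_abs_bound)
  also have "\<dots> \<le> (\<integral>x. \<bar>f x / a\<bar> powr p + \<bar>F x\<bar> powr p \<partial>M)"
  proof (rule integral_mono)
    show "\<bar>f x / a * \<bar>F x\<bar> powr (p - 1)\<bar> \<le> \<bar>f x / a\<bar> powr p + \<bar>F x\<bar> powr p" for x
    proof -
      have "\<bar>f x / a * \<bar>F x\<bar> powr (p - 1)\<bar> = \<bar>f x / a\<bar> * \<bar>F x\<bar> powr (p - 1)"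
        by (simp add: abs_mult)
      also have "\<dots> \<le> \<bar>f x / a\<bar> powr p + \<bar>F x\<bar> powr p"
        using one_le_p by (intro mult_powr_minus_one_le) auto
      finally show ?thesis .
    qed
  qed (intro integrable_abs integrable_pairing Bochner_Integration.integrable_add Lp_integrable * F)+
  also have "\<dots> = 1 + pint F"
    using Lp_integrable[OF *] Lp_integrable[OF F] unit by (simp add: pint_def)
  finally have "\<bar>pairing F (cls f) / a\<bar> \<le> 1 + pint F"
    by (simp add: pairing_cls[OF f F])
  then show ?thesis
    using a by (simp add: pos_divide_le_eq flip: a_def)
qed

lemma bounded_pairing:
  assumes "F \<in> Lp_funs p M"
  shows "bounded_functional (Lp p M) (pairing F)"
  unfolding bounded_functional_def
  using linear_pairing[OF assms] abs_pairing_le[OF _ assms]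
  by (auto simp: carrier_Lp norm_Lp)

section \<open>Disjoint sets carrying half of each term\<close>

lemma pint_min_le:
  assumes f: "f \<in> Lp_funs p M" and g: "g \<in> Lp_funs p M"
    and nonneg: "\<And>x. 0 \<le> f x" "\<And>x. 0 \<le> g x"
  shows "pint (\<lambda>x. min (g x) (f x)) \<le> pairing g (cls f)"
  unfolding pint_def pairing_cls[OF f g]
proof (rule integral_mono)
  show "\<bar>min (g x) (f x)\<bar> powr p \<le> f x * \<bar>g x\<bar> powr (p - 1)" for x
    using min_powr_le[OF one_le_p nonneg(1) nonneg(2), of x x] nonneg[of x]
    by (simp add: min.commute)
qed (use Lp_integrable[OF Lp_min[OF g f]] integrable_pairing[OF f g] in auto)

text \<open>
  Strictness makes these sets disjoint for different \<open>k\<close>, while the excluded points are exactly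
  those at which \<open>f k\<close> coincides with a minimum with another term.
\<close>

definition dominance_set :: "(nat \<Rightarrow> 'a \<Rightarrow> real) \<Rightarrow> nat \<Rightarrow> 'a set" where
  "dominance_set f k = {x \<in> space M. \<forall>i. i \<noteq> k \<longrightarrow> f i x < f k x}"

lemma dominance_set_measurable:
  assumes "\<And>k. f k \<in> Lp_funs p M"
  shows "dominance_set f k \<in> sets M"
proof -
  note [measurable] = assms[THEN Lp_measurable]
  show ?thesis unfolding dominance_set_def by measurable
qed

lemma disjoint_dominance_sets: "disjoint_family (dominance_set f)"
  unfolding disjoint_family_on_def
proof (intro ballI impI equals0I)
  fix i k x assume "i \<noteq> k" "x \<in> dominance_set f i \<inter> dominance_set f k"
  then have "f k x < f i x" "f i x < f k x" by (auto simp: dominance_set_def)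
  then show False by simp
qed

text \<open>
  Off the dominance set, \<open>f k\<close> equals one of the overlaps, so its \<open>p\<close>-th power is at most the sum of
  the \<open>p\<close>-th powers of all overlaps; the geometric bounds on their integrals add up to \<open>2 * \<eta>\<close>.
\<close>

lemma pint_le_dominance_set:
  assumes f: "\<And>k. f k \<in> Lp_funs p M" and nonneg: "\<And>k x. 0 \<le> f k x"
    and small: "\<And>i. i \<noteq> k \<Longrightarrow> pint (\<lambda>x. min (f i x) (f k x)) \<le> \<eta> * (1/2) ^ i"
    and "0 \<le> \<eta>"
  shows "pint (f k) \<le> pint (\<lambda>x. indicator (dominance_set f k) x * f k x) + 2 * \<eta>"
proof -
  note [measurable] = f[THEN Lp_measurable] dominance_set_measurable[of f, OF f]
  define h where "h i x = (if i = k then 0 else min (f i x) (f k x))" for i x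
  have h: "h i \<in> Lp_funs p M" for i
    by (cases "i = k") (simp_all add: h_def[abs_def] Lp_zero Lp_min f)
  note [measurable] = h[THEN Lp_measurable]
  have pint_h: "pint (h i) \<le> \<eta> * (1/2) ^ i" for i
  proof (cases "i = k")
    case True
    then show ?thesis using \<open>0 \<le> \<eta>\<close> by (simp add: h_def[abs_def] pint_def)
  next
    case False
    then show ?thesis using small[OF False] by (simp add: h_def[abs_def])
  qed
  let ?g = "\<lambda>x. indicator (dominance_set f k) x * f k x"
  have g: "?g \<in> Lp_funs p M"
    by (intro Lp_restrict f dominance_set_measurable)
  have "ennreal (pint (f k)) = (\<integral>\<^sup>+x. ennreal (\<bar>f k x\<bar> powr p) \<partial>M)"
    by (simp add: nn_integral_eq_pint f)
  also have "\<dots> \<le> (\<integral>\<^sup>+x. ennreal (\<bar>?g x\<bar> powr p) + (\<Sum>i. ennreal (\<bar>h i x\<bar> powr p)) \<partial>M)"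
  proof (rule nn_integral_mono)
    fix x assume x: "x \<in> space M"
    show "ennreal (\<bar>f k x\<bar> powr p) \<le> ennreal (\<bar>?g x\<bar> powr p) + (\<Sum>i. ennreal (\<bar>h i x\<bar> powr p))"
    proof (cases "x \<in> dominance_set f k")
      case True
      then show ?thesis by simp
    next
      case False
      then obtain i where "i \<noteq> k" "f k x \<le> f i x"
        using x by (auto simp: dominance_set_def not_less)
      then have "ennreal (\<bar>f k x\<bar> powr p) = ennreal (\<bar>h i x\<bar> powr p)"
        by (simp add: h_def min_absorb2)
      also have "\<dots> = (\<Sum>j\<in>{i}. ennreal (\<bar>h j x\<bar> powr p))"
        by simp
      also have "\<dots> \<le> (\<Sum>j. ennreal (\<bar>h j x\<bar> powr p))"
        by (rule sum_le_suminf) auto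
      finally show ?thesis by (simp add: add_increasing)
    qed
  qed
  also have "\<dots> = ennreal (pint ?g) + (\<Sum>i. ennreal (pint (h i)))"
    by (simp add: nn_integral_add nn_integral_suminf nn_integral_eq_pint[OF h] nn_integral_eq_pint[OF g])
  also have "(\<Sum>i. ennreal (pint (h i))) \<le> (\<Sum>i. ennreal (\<eta> * (1/2) ^ i))"
    using pint_h by (intro suminf_le) (auto intro: ennreal_leI)
  also have "\<dots> = ennreal (2 * \<eta>)"
    using \<open>0 \<le> \<eta>\<close> by (subst suminf_ennreal2) (auto simp: suminf_mult suminf_geometric summable_mult mult.commute)
  finally show ?thesis
    using pint_nonneg[of ?g] \<open>0 \<le> \<eta>\<close> by (simp flip: ennreal_plus)
qed

text \<open>
  Cutting \<open>f\<close> down to disjoint sets maps it to a sequence whose norms lie in \<open>l\<^sub>p\<close>.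
\<close>

lemma summable_pint_disjoint:
  assumes f: "f \<in> Lp_funs p M" and S: "\<And>k::nat. S k \<in> sets M" "disjoint_family S"
  shows "summable (\<lambda>k. pint (\<lambda>x. indicator (S k) x * f x))"
proof (rule bounded_imp_summable)
  fix N
  note [measurable] = S(1)
  have Sf: "(\<lambda>x. indicator T x * f x) \<in> Lp_funs p M" if "T \<in> sets M" for T
    using that by (intro Lp_restrict f)
  have U: "(\<Union>k\<le>N. S k) \<in> sets M" by measurable
  have pow: "\<bar>indicator T x * f x\<bar> powr p = indicator T x * \<bar>f x\<bar> powr p" for T x
    by (simp add: indicator_def)
  have "(\<Sum>k\<le>N. pint (\<lambda>x. indicator (S k) x * f x))
      = (\<integral>x. (\<Sum>k\<le>N. \<bar>indicator (S k) x * f x\<bar> powr p) \<partial>M)"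
    unfolding pint_def
    by (rule Bochner_Integration.integral_sum[symmetric]) (intro Lp_integrable Sf S)
  also have "\<dots> = pint (\<lambda>x. indicator (\<Union>k\<le>N. S k) x * f x)"
  proof -
    have "indicat_real (\<Union>k\<le>N. S k) x = (\<Sum>k\<le>N. indicator (S k) x)" for x
      using S(2) by (intro indicator_UN_disjoint) (auto simp: disjoint_family_on_def)
    then show ?thesis
      unfolding pint_def pow by (simp add: sum_distrib_right)
  qed
  also have "\<dots> \<le> pint f"
    by (rule pint_mono[OF Sf[OF U] f]) (auto simp: indicator_def)
  finally show "(\<Sum>k\<le>N. pint (\<lambda>x. indicator (S k) x * f x)) \<le> pint f" .
qed (rule pint_nonneg)

text \<open>
  Up to a constant factor, \<open>\<phi> k\<close> is the norming functional of \<open>f k\<close> cut down to \<open>S k\<close>. It sees an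
  argument only on \<open>S k\<close>, so its values on a fixed argument are \<open>p\<close>-summable by disjointness, and
  therefore \<open>n\<close>-summable because \<open>n \<ge> p\<close>.
\<close>

lemma regular_poly_bounded_below:
  assumes "p \<le> real n" "0 < \<epsilon>"
    and f: "\<And>k. f k \<in> Lp_funs p M" and nonneg: "\<And>k x. 0 \<le> f k x"
    and large: "\<And>k. \<epsilon> \<le> pnorm (f k)"
    and half: "\<And>k. pint (f k) \<le> 2 * pint (\<lambda>x. indicator (S k) x * f k x)"
    and S: "\<And>k::nat. S k \<in> sets M" "disjoint_family S"
  shows "\<exists>P. regular_poly n (Lp p M) P \<and> (\<forall>k. (\<epsilon> / 2) ^ n \<le> P (cls (f k)))"
proof -
  have "0 < n" using assms(1) one_le_p by (cases n) auto
  define F where "F k x = indicator (S k) x * f k x / pnorm (f k)" for k x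
  define \<phi> where "\<phi> k = pairing (F k)" for k
  have Sf: "(\<lambda>x. indicator (S k) x * g x) \<in> Lp_funs p M" if "g \<in> Lp_funs p M" for g k
    using that by (intro Lp_restrict S)
  have c: "0 < pnorm (f k)" for k using large[of k] \<open>0 < \<epsilon>\<close> by simp
  have F: "F k \<in> Lp_funs p M" for k
    using Lp_scale[OF Sf[OF f], of "1 / pnorm (f k)" k k] by (simp add: F_def[abs_def])
  have pint_F: "pint (F k) \<le> 1" for k
  proof -
    have "pint (F k) \<le> pint (\<lambda>x. 1 / pnorm (f k) * f k x)"
      using c by (intro pint_mono F Lp_scale f) (auto simp: F_def indicator_def)
    also have "\<dots> = 1"
      unfolding pint_scale using c[of k] by (simp add: powr_divide flip: pnorm_powr)
    finally show ?thesis .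
  qed
  have local_bound: "\<bar>\<phi> k (cls g)\<bar> \<le> 2 * pnorm (\<lambda>x. indicator (S k) x * g x)"
    if g: "g \<in> Lp_funs p M" for k g
  proof -
    have "\<phi> k (cls g) = pairing (F k) (cls (\<lambda>x. indicator (S k) x * g x))"
      unfolding \<phi>_def pairing_cls[OF g F] pairing_cls[OF Sf[OF g] F]
      by (intro Bochner_Integration.integral_cong) (auto simp: F_def indicator_def)
    also have "\<bar>\<dots>\<bar> \<le> (1 + pint (F k)) * pnorm (\<lambda>x. indicator (S k) x * g x)"
      by (rule abs_pairing_le[OF Sf[OF g] F])
    also have "\<dots> \<le> 2 * pnorm (\<lambda>x. indicator (S k) x * g x)"
      using pint_F[of k] pnorm_nonneg by (intro mult_right_mono) auto
    finally show ?thesis .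
  qed
  have summ: "summable (\<lambda>k. \<bar>\<phi> k X\<bar> ^ n)" if X: "X \<in> vcarrier (Lp p M)" for X
  proof -
    obtain g where g: "g \<in> Lp_funs p M" "X = cls g" using X by (auto simp: carrier_Lp)
    let ?g = "\<lambda>k x. indicator (S k) x * g x"
    show ?thesis
    proof (rule summable_comparison_test')
      \<comment> \<open>Of the \<open>n\<close> powers of \<open>pnorm (?g k)\<close>, \<open>p\<close> give a summable integral and \<open>n - p \<ge> 0\<close> are bounded.\<close>
      show "summable (\<lambda>k. 2 ^ n * pnorm g powr (real n - p) * pint (?g k))"
        by (intro summable_mult summable_pint_disjoint g S)
      show "norm (\<bar>\<phi> k X\<bar> ^ n) \<le> 2 ^ n * pnorm g powr (real n - p) * pint (?g k)" for k
      proof -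
        have le: "pnorm (?g k) \<le> pnorm g"
          using p_pos unfolding pnorm_def
          by (intro powr_mono2 pint_mono pint_nonneg Sf g) (auto simp: indicator_def)
        have "\<bar>\<phi> k X\<bar> ^ n \<le> (2 * pnorm (?g k)) ^ n"
          using local_bound[OF g(1)] g(2) by (intro power_mono) auto
        also have "\<dots> = 2 ^ n * (pnorm (?g k) powr (real n - p) * pnorm (?g k) powr p)"
          using \<open>0 < n\<close> pnorm_nonneg[of "?g k"]
          by (cases "pnorm (?g k) = 0") (auto simp: power_mult_distrib powr_realpow simp flip: powr_add)
        also have "\<dots> \<le> 2 ^ n * (pnorm g powr (real n - p) * pnorm (?g k) powr p)"
          using le pnorm_nonneg assms(1) by (intro mult_left_mono mult_right_mono powr_mono2) auto
        finally show ?thesis by (simp add: pnorm_powr mult.assoc)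
      qed
    qed
  qed
  have lower: "\<epsilon> / 2 \<le> \<phi> k (cls (f k))" for k
  proof -
    have "\<phi> k (cls (f k)) = (\<integral>x. \<bar>indicator (S k) x * f k x\<bar> powr p / pnorm (f k) powr (p - 1) \<partial>M)"
      unfolding \<phi>_def pairing_cls[OF f F]
    proof (rule Bochner_Integration.integral_cong[OF refl])
      fix x
      show "f k x * \<bar>F k x\<bar> powr (p - 1)
          = \<bar>indicator (S k) x * f k x\<bar> powr p / pnorm (f k) powr (p - 1)"
        using powr_mult_base[OF nonneg, of k x "p - 1"] nonneg[of k x] c[of k]
        by (auto simp: F_def indicator_def powr_divide)
    qed
    also have "\<dots> = pint (\<lambda>x. indicator (S k) x * f k x) / pnorm (f k) powr (p - 1)"
      by (simp add: pint_def)
    also have "\<dots> \<ge> (pnorm (f k) powr p / 2) / pnorm (f k) powr (p - 1)"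
      using half[of k] by (intro divide_right_mono) (auto simp: pnorm_powr)
    also have "(pnorm (f k) powr p / 2) / pnorm (f k) powr (p - 1) = pnorm (f k) / 2"
      using c[of k] powr_mult_base[of "pnorm (f k)" "p - 1"] by (simp add: field_simps)
    finally show ?thesis using large[of k] by simp
  qed
  have "regular_poly n (Lp p M) (\<lambda>X. \<Sum>k. \<phi> k X ^ n)"
    using \<open>0 < n\<close> summ
    by (intro regular_poly_sum_of_powers) (auto simp: \<phi>_def linear_pairing F pairing_nonneg)
  moreover have "(\<epsilon> / 2) ^ n \<le> (\<Sum>k. \<phi> k (cls (f j)) ^ n)" for j
  proof -
    have X: "cls (f j) \<in> vcarrier (Lp p M)" by (simp add: carrier_Lp f)
    have nn: "0 \<le> \<phi> k (cls (f j))" for k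
      unfolding \<phi>_def by (rule pairing_nonneg[OF F X]) (simp add: zero_Lp le_Lp Lp_zero f nonneg)
    have "(\<epsilon> / 2) ^ n \<le> \<phi> j (cls (f j)) ^ n"
      using lower[of j] \<open>0 < \<epsilon>\<close> by (intro power_mono) auto
    also have "\<dots> \<le> (\<Sum>k. \<phi> k (cls (f j)) ^ n)"
      using sum_le_suminf[of "\<lambda>k. \<phi> k (cls (f j)) ^ n" "{j}"] summ[OF X] nn by simp
    finally show ?thesis .
  qed
  ultimately show ?thesis by blast
qed

text \<open>
  By contradiction: along a sparse subsequence of terms of norm at least \<open>\<epsilon>\<close>, the polynomial of the
  previous lemma, taken with the dominance sets, stays above \<open>(\<epsilon> / 2) ^ n\<close>.
\<close>

lemma n_PPS_lattice_Lp:
  assumes "p \<le> real n"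
  shows "n_PPS_lattice n (Lp p M)"
  unfolding n_PPS_lattice_def
proof (intro conjI banach_lattice_Lp allI impI, elim conjE)
  fix s
  assume s: "\<forall>j. s j \<in> vcarrier (Lp p M) \<and> vle (Lp p M) (vzero (Lp p M)) (s j)"
    and weak: "weakly_null (Lp p M) s"
    and polys: "\<forall>P. regular_poly n (Lp p M) P \<longrightarrow> (\<lambda>j. P (s j)) \<longlonglongrightarrow> 0"
  have "\<exists>f. f \<in> Lp_funs p M \<and> (\<forall>x. 0 \<le> f x) \<and> s j = cls f" for j
  proof -
    obtain g where g: "g \<in> Lp_funs p M" "s j = cls g"
      using s by (auto simp: carrier_Lp)
    then have "AE x in M. 0 \<le> g x"
      using s[rule_format, of j] by (simp add: zero_Lp le_Lp Lp_zero)
    then have "s j = cls (\<lambda>x. \<bar>g x\<bar>)"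
      unfolding g(2) by (intro cls_eqI g Lp_abs) (auto elim: eventually_mono)
    then show ?thesis using g Lp_abs by (intro exI[of _ "\<lambda>x. \<bar>g x\<bar>"]) auto
  qed
  then obtain f where f: "\<And>j. f j \<in> Lp_funs p M" and nonneg: "\<And>j x. 0 \<le> f j x"
    and s_f: "\<And>j. s j = cls (f j)"
    by metis
  have pairing_null: "(\<lambda>j. pairing (f i) (cls (f j))) \<longlonglongrightarrow> 0" for i
    using weak bounded_pairing[OF f] by (simp add: weakly_null_def s_f)
  have "(\<lambda>j. pnorm (f j)) \<longlonglongrightarrow> 0"
  proof (rule ccontr)
    assume "\<not> (\<lambda>j. pnorm (f j)) \<longlonglongrightarrow> 0"
    then obtain \<epsilon> where \<epsilon>: "0 < \<epsilon>" and often: "\<And>N. \<exists>j\<ge>N. \<epsilon> \<le> pnorm (f j)"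
      using pnorm_nonneg by (auto simp: LIMSEQ_def not_less)
    have inf: "infinite {j. \<epsilon> \<le> pnorm (f j)}"
      using often by (auto simp: infinite_nat_iff_unbounded_le)
    \<comment> \<open>The total overlap \<open>2 * \<eta>\<close> is then at most half of the \<open>p\<close>-th power integral of each term.\<close>
    define \<eta> where "\<eta> = \<epsilon> powr p / 4"
    have \<eta>: "0 < \<eta>" using \<epsilon> by (simp add: \<eta>_def)
    obtain r where r: "strict_mono r" and large: "\<And>k. \<epsilon> \<le> pnorm (f (r k))"
      and small: "\<And>i k. i < k \<Longrightarrow> pairing (f (r i)) (cls (f (r k))) < \<eta> * (1/2) ^ (i + k)"
      by (rule subsequence_with_small_pairings
          [of "\<lambda>i j. pairing (f i) (cls (f j))", OF pairing_null inf \<eta>]) auto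
    have small_min: "pint (\<lambda>x. min (f (r i) x) (f (r k) x)) \<le> \<eta> * (1/2) ^ i" if "i \<noteq> k" for i k
    proof -
      have ordered: "pint (\<lambda>x. min (f (r i) x) (f (r k) x)) \<le> \<eta> * (1/2) ^ (i + k)"
        if "i < k" for i k
        using pint_min_le[OF f f nonneg nonneg, of "r i" "r k"] small[OF that] by linarith
      have "pint (\<lambda>x. min (f (r i) x) (f (r k) x)) \<le> \<eta> * (1/2) ^ (i + k)"
        using ordered[of i k] ordered[of k i] that
        by (cases "i < k") (auto simp: min.commute add.commute)
      also have "\<dots> \<le> \<eta> * (1/2) ^ i"
        using \<eta> by (intro mult_left_mono power_decreasing) auto
      finally show ?thesis .
    qed
    let ?f = "\<lambda>k. f (r k)"
    have half: "pint (?f k) \<le> 2 * pint (\<lambda>x. indicator (dominance_set ?f k) x * ?f k x)" for k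
    proof -
      have "pint (?f k) \<le> pint (\<lambda>x. indicator (dominance_set ?f k) x * ?f k x) + 2 * \<eta>"
        using \<eta> small_min by (intro pint_le_dominance_set f nonneg) auto
      moreover have "\<epsilon> powr p \<le> pint (?f k)"
        using large[of k] \<epsilon> p_pos by (auto simp flip: pnorm_powr intro!: powr_mono2)
      ultimately show ?thesis by (simp add: \<eta>_def)
    qed
    obtain P where P: "regular_poly n (Lp p M) P" and below: "\<And>k. (\<epsilon> / 2) ^ n \<le> P (s (r k))"
      using regular_poly_bounded_below[OF assms \<epsilon> f nonneg large half
          dominance_set_measurable[of ?f, OF f] disjoint_dominance_sets] s_f by auto
    have "(\<lambda>k. P (s (r k))) \<longlonglongrightarrow> 0"
      using polys P LIMSEQ_subseq_LIMSEQ[OF _ r] by (fastforce simp: comp_def)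
    then have "(\<epsilon> / 2) ^ n \<le> 0"
      using below by (intro LIMSEQ_le_const) auto
    moreover have "0 < (\<epsilon> / 2) ^ n" using \<epsilon> by simp
    ultimately show False by simp
  qed
  then show "norm_null (Lp p M) s"
    by (simp add: norm_null_def s_f norm_Lp f)
qed

end

theorem theorem3p6:
  fixes M :: "'a measure" and p :: real and n :: nat
  assumes "1 \<le> p" and "p \<le> real n"
  shows "n_PPS_lattice n (Lp p M)"
proof -
  interpret lebesgue_exponent p M
    using assms(1) by unfold_locales
  show ?thesis
    using assms(2) by (rule n_PPS_lattice_Lp)
qed

end
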